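(* For any $q\ge5$, in $\mathrm{PG}(3,q)$, the imaginary chords of the twisted cubic $\mathcal{C}$ form an orbit under $G_q$. The subgroup of $G_q$ fixing an imaginary chord has size $2(q+1)$. For $q$ odd, the line $\ell_1$ through the points $\mathbf{P}(1,0,\rho,0)$ and $\mathbf{P}(0,1,0,\rho)$, with $\rho$ a non-square element of $\mathbb{F}_q$, is an imaginary chord. An element $\Psi$ of the subgroup of $G_q$ fixing $\ell_1$ has a matrix of the form \[ \left[ \begin{array}{cccc} \alpha d^3&\alpha \rho b d^2&\alpha \rho^2 b^2 d&\alpha \rho^3 b^3\\ 3bd^2&d^3+2\rho b^2d&\rho^2b^3+2\rho b d^2&3\rho^2b^2d\\ 3\alpha b^2d&\alpha\rho b^3+2\alpha bd^2&\alpha d^3+2\alpha\rho b^2 d&3\alpha\rho bd^2\\ b^3&b^2d&bd^2&d^3 \end{array} \right], \] with $\alpha \in \{ -1,1\}$ and $b,d \in \mathbb{F}_q$ not both $0$. For $q$ even, the line $\ell_2$ through the points $\mathbf{P}(\eta+1,1,1,0)$ and $\mathbf{P}(\eta,\eta,0,1)$, with $\eta$ an element of $\mathbb{F}_q$ of absolute trace $1$, is an imaginary chord. An element $\Psi$ of the subgroup of $G_q$ fixing $\ell_2$ has a matrix of the form \[ \left[ \begin{array}{cccc} A^3&cA^2&c^2A&c^3\\ A^2B&dA^2&c^2B&c^2d\\ AB^2&cB^2&Ad^2&cd^2\\ B^3&dB^2&d^2B&d^3 \end{array} \right], \] where $A = \alpha c+d$, $B= \eta c+(\alpha+1)d$,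 $\alpha \in \{ 0,1\}$, and $c,d \in \mathbb{F}_q$ not both $0$.
   Context: Let $\mathbf{P}(x_0,x_1,x_2,x_3)$ denote the point of $\mathrm{PG}(3,q)$ with homogeneous coordinates $x_i\in\mathbb{F}_q$. Let $\mathcal{C}=\{P(t): t\in\mathbb{F}_q\cup\{\infty\}\}$ be the twisted cubic, where $P(t)=\mathbf{P}(t^3,t^2,t,1)$ for $t\in\mathbb{F}_q$ and $P(\infty)=\mathbf{P}(1,0,0,0)$. Let $G_q$ be the group of projectivities of $\mathrm{PG}(3,q)$ fixing $\mathcal{C}$; for $q\ge5$, $G_q\cong PGL(2,q)$, and a projectivity of $G_q$ acts on points by $[x_0,x_1,x_2,x_3]\mapsto[x_0,x_1,x_2,x_3]M$ where $M$ has the general form \[ M=\left[ \begin{array}{cccc} a^3&a^2c&ac^2&c^3\\ 3a^2b&a^2d+2abc&bc^2+2acd&3c^2d\\ 3ab^2&b^2c+2abd&ad^2+2bcd&3cd^2\\ b^3&b^2d&bd^2&d^3 \end{array} \right],\quad a,b,c,d\in\mathbb{F}_q,\ ad-bc\ne0, \] defined up to a nonzero scalar factor. An imaginary chord of $\mathcal{C}$ is a line of $\mathrm{PG}(3,q)$ joining a pair of complex conjugate points of $\mathcal{C}$ (points $P(t)$ with $t\in\mathbb{F}_{q^2}\setminus\mathbb{F}_q$ and $P(t^q)$). *)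

theory Defs
  imports Main
begin

text \<open>Setting: a finite field k of order q^2 (= F_{q^2}); F_q is its subfield
  {x. x^q = x}.  Vectors of PG(3,q) are lists of length 4; matrices are lists of
  4 rows; projectivities act on row vectors by x \<mapsto> x M.\<close>

definition Fq :: "nat \<Rightarrow> 'k::field set" where
  "Fq q = {x. x ^ q = x}"

definition vsc :: "'k::field \<Rightarrow> 'k list \<Rightarrow> 'k list" where
  "vsc c x = map (\<lambda>y. c * y) x"

definition vadd :: "'k::field list \<Rightarrow> 'k list \<Rightarrow> 'k list" where
  "vadd x y = map (\<lambda>(a, b). a + b) (zip x y)"

definition is_fqvec :: "nat \<Rightarrow> 'k::field list \<Rightarrow> bool" where
  "is_fqvec q x \<longleftrightarrow> length x = 4 \<and> set x \<subseteq> Fq q"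

text \<open>The F_q-subspace spanned by u, v (a line of PG(3,q) when u, v independent).\<close>
definition fq_span :: "nat \<Rightarrow> 'k::field list \<Rightarrow> 'k list \<Rightarrow> 'k list set" where
  "fq_span q u v = {vadd (vsc a u) (vsc b v) | a b. a \<in> Fq q \<and> b \<in> Fq q}"

definition k_span :: "'k::field list \<Rightarrow> 'k list \<Rightarrow> 'k list set" where
  "k_span u v = {vadd (vsc a u) (vsc b v) | a b. True}"

definition fq_indep :: "nat \<Rightarrow> 'k::field list \<Rightarrow> 'k list \<Rightarrow> bool" where
  "fq_indep q u v \<longleftrightarrow>
     (\<forall>a\<in>Fq q. \<forall>b\<in>Fq q. vadd (vsc a u) (vsc b v) = replicate 4 0 \<longrightarrow> a = 0 \<and> b = 0)"

definition Ppt :: "'k::field \<Rightarrow> 'k list" where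
  "Ppt t = [t ^ 3, t ^ 2, t, 1]"

text \<open>An imaginary chord: a line of PG(3,q) whose extension to F_{q^2} contains
  P(t) and P(t^q) with t in F_{q^2} \ F_q (these two points are distinct, so the
  line is the line joining them).\<close>
definition imag_chord :: "nat \<Rightarrow> 'k::field list set \<Rightarrow> bool" where
  "imag_chord q L \<longleftrightarrow>
     (\<exists>u v t. is_fqvec q u \<and> is_fqvec q v \<and> fq_indep q u v \<and> L = fq_span q u v \<and>
        t \<notin> Fq q \<and> Ppt t \<in> k_span u v \<and> Ppt (t ^ q) \<in> k_span u v)"

definition vecmat :: "'k::field list \<Rightarrow> 'k list list \<Rightarrow> 'k list" where
  "vecmat x M = map (\<lambda>j. \<Sum>i<4. x ! i * M ! i ! j) [0..<4]"

definition Mq :: "'k::field \<Rightarrow> 'k \<Rightarrow> 'k \<Rightarrow> 'k \<Rightarrow> 'k list list" where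
  "Mq a b c d =
     [[a^3, a^2*c, a*c^2, c^3],
      [3*a^2*b, a^2*d + 2*a*b*c, b*c^2 + 2*a*c*d, 3*c^2*d],
      [3*a*b^2, b^2*c + 2*a*b*d, a*d^2 + 2*b*c*d, 3*c*d^2],
      [b^3, b^2*d, b*d^2, d^3]]"

definition msc :: "'k::field \<Rightarrow> 'k list list \<Rightarrow> 'k list list" where
  "msc c M = map (map (\<lambda>y. c * y)) M"

definition proj_class :: "nat \<Rightarrow> 'k::field list list \<Rightarrow> 'k list list set" where
  "proj_class q M = {msc c M | c. c \<in> Fq q \<and> c \<noteq> 0}"

definition Gq :: "nat \<Rightarrow> 'k::field list list set set" where
  "Gq q = {proj_class q (Mq a b c d) | a b c d.
             a \<in> Fq q \<and> b \<in> Fq q \<and> c \<in> Fq q \<and> d \<in> Fq q \<and> a * d - b * c \<noteq> 0}"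

definition line_image :: "'k::field list list \<Rightarrow> 'k list set \<Rightarrow> 'k list set" where
  "line_image M L = (\<lambda>x. vecmat x M) ` L"

definition stab :: "nat \<Rightarrow> 'k::field list set \<Rightarrow> 'k list list set set" where
  "stab q L = {g \<in> Gq q. \<forall>M\<in>g. line_image M L = L}"

definition abs_trace :: "nat \<Rightarrow> 'k::field \<Rightarrow> 'k" where
  "abs_trace q x = (\<Sum>i<(LEAST h. 2 ^ h = q). x ^ (2 ^ i))"

end

theory Submission
  imports Defs "HOL-Algebra.Sylow" "HOL-Algebra.Multiplicative_Group"
    "HOL-Computational_Algebra.Polynomial"
begin

text \<open>
  For \<open>t\<close> in \<open>k\<close> outside \<open>F\<^sub>q\<close>, the imaginary chord through \<open>P(t)\<close> and its conjugate is the set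
  of all \<open>Tr(m P(t))\<close> with \<open>m \<in> k\<close>, where \<open>Tr x = x + x\<^sup>q\<close>. Since
  \<open>P(t) M = (c t + d)\<^sup>3 P((a t + b) / (c t + d))\<close>, a projectivity moves chords as the fractional
  linear map moves \<open>t\<close>. The chord determines trace and norm of \<open>t\<close>, hence the pair
  \<open>{t, t\<^sup>q}\<close>; affine maps are already transitive on the \<open>t\<close>, and the stabiliser of the chord is given
  by the equations \<open>a t + b = s (c t + d)\<close> with \<open>s \<in> {t, t\<^sup>q}\<close>, in which \<open>(c : d)\<close> is free.
\<close>

section \<open>Finite fields and a counting principle\<close>

text \<open>By Sylow, any prime \<open>r\<close> dividing the order of the field yields a nonzero \<open>x\<close>
  with \<open>r x = 0\<close>, so \<open>r\<close> is the characteristic.\<close>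
lemma prime_dvd_card_field_imp_CHAR:
  fixes r :: nat
  assumes "prime r" and "r dvd card (UNIV :: 'k::{finite,field} set)"
  shows "r = CHAR('k)"
proof -
  define G where "G = \<lparr>carrier = (UNIV :: 'k set), monoid.mult = (+), one = (0 :: 'k)\<rparr>"
  have "group G"
    unfolding G_def
    by (rule groupI) (auto simp: add.assoc, metis add.left_inverse)
  then interpret G: group G .
  \<comment> \<open>Here \<open>m\<close> may itself be a multiple of \<open>r\<close>; Sylow's
    theorem with exponent 1 still yields a subgroup of order exactly \<open>r\<close>.\<close>
  obtain m where m: "Coset.order G = r ^ 1 * m"
    using assms(2) by (auto simp: G_def Coset.order_def elim: dvdE)
  obtain H where H: "subgroup H G" "card H = r ^ 1"
    using sylow_thm[OF assms(1) \<open>group G\<close> m] by (auto simp: G_def)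
  have "card H > 1"
    using H(2) assms(1) prime_gt_1_nat by simp
  then have "H \<noteq> {0}"
    by auto
  moreover have "0 \<in> H"
    using subgroup.one_closed[OF H(1)] by (simp add: G_def)
  ultimately obtain x where x: "x \<in> H" "x \<noteq> 0"
    by blast
  have pow: "y [^]\<^bsub>G\<^esub> n = of_nat n * y" for y and n :: nat
    by (induction n) (auto simp: G_def algebra_simps nat_pow_def)
  interpret H: group "G\<lparr>carrier := H\<rparr>"
    by (rule subgroup.subgroup_is_group[OF H(1) \<open>group G\<close>])
  have "x [^]\<^bsub>G\<lparr>carrier := H\<rparr>\<^esub> Coset.order (G\<lparr>carrier := H\<rparr>) = \<one>\<^bsub>G\<lparr>carrier := H\<rparr>\<^esub>"
    by (rule H.pow_order_eq_1) (use x in simp)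
  then have "of_nat r * x = 0"
    using H(2) pow[of x r] by (simp add: Coset.order_def G_def nat_pow_def)
  then have "CHAR('k) dvd r"
    using x(2) by (simp add: of_nat_eq_0_iff_char_dvd)
  moreover have "prime CHAR('k)"
    by (simp add: prime_CHAR_semidom finite_imp_CHAR_pos)
  ultimately show ?thesis
    using assms(1) primes_dvd_imp_eq by metis
qed

text \<open>Multiplication by a nonzero \<open>x\<close> permutes the nonzero elements; comparing
  their product before and after gives \<open>x ^ (card UNIV - 1) = 1\<close>.\<close>

lemma card_field_power_eq_same:
  fixes x :: "'k::{finite,field}"
  shows "x ^ card (UNIV :: 'k set) = x"
proof (cases "x = 0")
  case False
  have pos: "card (UNIV :: 'k set) > 0"
    by (simp add: finite_UNIV_card_ge_0)
  have "(\<Prod>y\<in>UNIV-{0}. x * y) = (\<Prod>y\<in>UNIV-{0}. y)"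
    by (rule prod.reindex_bij_witness[of _ "\<lambda>y. y / x" "\<lambda>y. x * y"]) (use False in auto)
  then have "x ^ (card (UNIV :: 'k set) - 1) * \<Prod>(UNIV-{0}) = \<Prod>(UNIV-{0::'k})"
    by (simp add: prod.distrib)
  moreover have "\<Prod>(UNIV-{0::'k}) \<noteq> 0"
    by simp
  ultimately have "x ^ (card (UNIV :: 'k set) - 1) = 1"
    by simp
  then show ?thesis
    using pos by (metis Suc_diff_1 mult_1_right power_Suc)
qed (simp add: finite_UNIV_card_ge_0)

text \<open>With fibres of at most two points, the image is at least half as large as the domain.
  This will produce square roots and roots of \<open>x^2 + x = r\<close> in the quadratic
  extension.\<close>

lemma two_to_one_surj:
  assumes "finite S" and "finite T" and "f ` S \<subseteq> T" and "2 * card T \<le> card S"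
    and fibre: "\<And>x y. x \<in> S \<Longrightarrow> y \<in> S \<Longrightarrow> f y = f x \<Longrightarrow> y = x \<or> y = g x"
  shows "f ` S = T"
proof -
  have "card {y \<in> S. f y = z} \<le> 2" if "z \<in> f ` S" for z
  proof -
    obtain x where x: "x \<in> S" "z = f x"
      using \<open>z \<in> f ` S\<close> by blast
    have "card {y \<in> S. f y = z} \<le> card {x, g x}"
      using fibre x by (intro card_mono) auto
    also have "\<dots> \<le> 2"
      by (simp add: card_insert_if)
    finally show ?thesis .
  qed
  note fibre_card = this
  have "card S = (\<Sum>z\<in>f ` S. card {y \<in> S. f y = z})"
    using sum.image_gen[OF assms(1), of "\<lambda>_. 1::nat" f] by simp
  also have "\<dots> \<le> card (f ` S) * 2"
    by (rule sum_bounded_above[where K = 2, THEN order_trans]) (use fibre_card in auto)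
  finally have "card T \<le> card (f ` S)"
    using assms(4) by simp
  then show ?thesis
    using assms(2,3) card_seteq by blast
qed

section \<open>The field of order q^2, its conjugation and trace\<close>

locale quadratic_extension =
  fixes q :: nat and K :: "'k::{finite,field} itself"
  assumes card_UNIV: "card (UNIV :: 'k set) = q\<^sup>2"
begin

lemma q_ge_2: "2 \<le> q"
proof -
  have "card {0, 1 :: 'k} \<le> q\<^sup>2"
    unfolding card_UNIV[symmetric] by (rule card_mono) auto
  then have "q \<noteq> 0" "q \<noteq> 1"
    by (auto intro!: gr0I)
  then show ?thesis
    by simp
qed

lemma prime_CHAR: "prime CHAR('k)"
  by (simp add: prime_CHAR_semidom finite_imp_CHAR_pos)

text \<open>A prime factor of \<open>q\<close> divides the order \<open>q^2\<close> of the field and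
  is therefore the characteristic.\<close>

lemma q_power_of_CHAR: obtains h where "q = CHAR('k) ^ h" "h > 0"
proof -
  have "prime_factors q \<subseteq> {CHAR('k)}"
    by (auto simp: in_prime_factors_iff card_UNIV
        intro!: prime_dvd_card_field_imp_CHAR dvd_trans[OF _ dvd_power])
  then have "q = CHAR('k) ^ multiplicity CHAR('k) q"
    using q_ge_2 prime_factorization_nat[of q]
    by (cases "prime_factors q = {}") (auto simp: subset_singleton_iff)
  moreover from this have "multiplicity CHAR('k) q > 0"
    using q_ge_2 by (intro gr0I) simp
  ultimately show ?thesis
    using that by blast
qed

text \<open>The Frobenius automorphism of order two with fixed field \<open>Fq q\<close>, in the
  role of complex conjugation.\<close>

definition conjg :: "'k \<Rightarrow> 'k" where
  "conjg x = x ^ q"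

definition tr :: "'k \<Rightarrow> 'k" where
  "tr x = x + conjg x"

lemma mem_Fq: "x \<in> Fq q \<longleftrightarrow> conjg x = x"
  by (simp add: Fq_def conjg_def)

lemma conjg_add [simp]: "conjg (x + y) = conjg x + conjg y"
  unfolding conjg_def
  by (rule q_power_of_CHAR) (simp add: freshmans_dream'[OF prime_CHAR])

lemma conjg_0 [simp]: "conjg 0 = 0" and conjg_1 [simp]: "conjg 1 = 1"
  using q_ge_2 by (auto simp: conjg_def)

lemma conjg_minus [simp]: "conjg (- x) = - conjg x"
  using conjg_add[of x "- x"] by (simp add: add_eq_0_iff)

lemma conjg_diff [simp]: "conjg (x - y) = conjg x - conjg y"
  using conjg_add[of x "- y"] by simp

lemma conjg_mult [simp]: "conjg (x * y) = conjg x * conjg y"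
  by (simp add: conjg_def power_mult_distrib)

lemma conjg_divide [simp]: "conjg (x / y) = conjg x / conjg y"
  by (simp add: conjg_def power_divide)

lemma conjg_power [simp]: "conjg (x ^ n) = conjg x ^ n"
  by (simp add: conjg_def flip: power_mult) (simp add: mult.commute)

lemma conjg_conj [simp]: "conjg (conjg x) = x"
  unfolding conjg_def using card_field_power_eq_same[of x] card_UNIV
  by (simp add: power2_eq_square flip: power_mult)

lemma conjg_numeral [simp]: "conjg (numeral n) = numeral n"
  by (induction n) (metis numeral_One conjg_1, metis numeral_Bit0 conjg_add,
      metis numeral_Bit1 conjg_add conjg_1)

lemma conjg_in_Fq_iff [simp]: "conjg t \<in> Fq q \<longleftrightarrow> t \<in> Fq q"
  by (auto simp: mem_Fq)

lemma tr_in_Fq [simp]: "tr x \<in> Fq q"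
  by (simp add: mem_Fq tr_def)

lemma tr_add: "tr (x + y) = tr x + tr y"
  by (simp add: tr_def)

lemma tr_sum: "tr (sum f A) = (\<Sum>i\<in>A. tr (f i))"
  by (induction A rule: infinite_finite_induct) (simp_all add: tr_add, simp_all add: tr_def)

lemma tr_mult_Fq: "a \<in> Fq q \<Longrightarrow> tr (a * x) = a * tr x"
  by (simp add: tr_def mem_Fq algebra_simps)

lemma Fq_closed [simp]:
  fixes x y :: 'k
  shows
  "(0 :: 'k) \<in> Fq q" "(1 :: 'k) \<in> Fq q"
  "x \<in> Fq q \<Longrightarrow> y \<in> Fq q \<Longrightarrow> x + y \<in> Fq q"
  "x \<in> Fq q \<Longrightarrow> y \<in> Fq q \<Longrightarrow> x - y \<in> Fq q"
  "x \<in> Fq q \<Longrightarrow> - x \<in> Fq q"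
  "x \<in> Fq q \<Longrightarrow> y \<in> Fq q \<Longrightarrow> x * y \<in> Fq q"
  "x \<in> Fq q \<Longrightarrow> y \<in> Fq q \<Longrightarrow> x / y \<in> Fq q"
  "x \<in> Fq q \<Longrightarrow> x ^ n \<in> Fq q"
  "(numeral k :: 'k) \<in> Fq q"
  by (simp_all add: mem_Fq)

section \<open>The order of the subfield and coordinates over it\<close>

text \<open>The subfield is the root set of \<open>X^q - X\<close>. The opposite bound needs the
  basis \<open>(t, 1)\<close> and comes with \<open>card_Fq\<close>.\<close>

lemma card_Fq_le: "card (Fq q :: 'k set) \<le> q"
proof -
  define p :: "'k poly" where "p = monom 1 q - monom 1 1"
  have "coeff p q = 1"
    using q_ge_2 by (simp add: p_def)
  then have "p \<noteq> 0"
    by auto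
  have "(Fq q :: 'k set) = {x. poly p x = 0}"
    by (auto simp: Fq_def p_def poly_monom)
  moreover have "degree p \<le> q"
    using q_ge_2 unfolding p_def
    by (intro degree_diff_le degree_monom_le order_trans[OF degree_monom_le]) auto
  ultimately show ?thesis
    using card_poly_roots_bound[OF \<open>p \<noteq> 0\<close>] by simp
qed

lemma exists_notin_Fq: obtains t :: 'k where "t \<notin> Fq q"
proof -
  have "(Fq q :: 'k set) \<noteq> UNIV"
  proof
    assume "(Fq q :: 'k set) = UNIV"
    then have "q * q \<le> q"
      using card_Fq_le card_UNIV by (simp add: power2_eq_square)
    then show False
      using q_ge_2 by (simp add: not_le[symmetric])
  qed
  then show ?thesis
    using that by blast
qed

text \<open>Outside the subfield, \<open>(t, 1)\<close> is a basis of \<open>k\<close>; \<open>coef t z\<close> is the first coordinate of \<open>z\<close>.\<close>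
definition coef :: "'k \<Rightarrow> 'k \<Rightarrow> 'k" where
  "coef t z = (z - conjg z) / (t - conjg t)"

text \<open>Numerator and denominator of \<open>coef t z\<close> both change sign under
  conjugation.\<close>

lemma coef_in_Fq: "coef t z \<in> Fq q"
proof -
  have "(conjg z - z) / (conjg t - t) = (z - conjg z) / (t - conjg t)"
    by (metis minus_diff_eq minus_divide_divide)
  then show ?thesis
    by (simp add: mem_Fq coef_def)
qed

lemma coef_rest_in_Fq:
  assumes "t \<notin> Fq q"
  shows "z - coef t z * t \<in> Fq q"
proof -
  have "coef t z * (t - conjg t) = z - conjg z"
    using assms by (auto simp: coef_def mem_Fq)
  moreover have "conjg (coef t z) = coef t z"
    using coef_in_Fq by (simp add: mem_Fq)
  ultimately show ?thesis
    by (simp add: mem_Fq algebra_simps)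
qed

lemma Fq_basis_unique:
  fixes t :: 'k
  assumes "t \<notin> Fq q" "a \<in> Fq q" "b \<in> Fq q" "a' \<in> Fq q" "b' \<in> Fq q"
    and eq: "a * t + b = a' * t + b'"
  shows "a = a' \<and> b = b'"
proof -
  have "a = a'"
  proof (rule ccontr)
    assume "a \<noteq> a'"
    then have "t = (b' - b) / (a - a')"
      using eq by (simp add: field_simps)
    then show False
      using assms(1-5) by simp
  qed
  then show ?thesis
    using eq by simp
qed

text \<open>The combinations \<open>a * t + b\<close> cover \<open>k\<close>, so \<open>q^2\<close>
  is at most the square of the order of the subfield; the root count bounds it from above.\<close>

lemma card_Fq: "card (Fq q :: 'k set) = q"
proof -
  obtain t :: 'k where t: "t \<notin> Fq q"
    by (rule exists_notin_Fq)
  have "UNIV \<subseteq> (\<lambda>(a, b). a * t + b) ` (Fq q \<times> Fq q)"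
  proof
    fix z :: 'k
    show "z \<in> (\<lambda>(a, b). a * t + b) ` (Fq q \<times> Fq q)"
      by (rule image_eqI[of _ _ "(coef t z, z - coef t z * t)"])
        (simp_all add: coef_in_Fq coef_rest_in_Fq[OF t])
  qed
  then have "q\<^sup>2 \<le> card (Fq q \<times> Fq q :: ('k \<times> 'k) set)"
    unfolding card_UNIV[symmetric]
    by (meson card_image_le card_mono finite finite_imageI order_trans)
  then have "q \<le> card (Fq q :: 'k set)"
    by (simp add: card_cartesian_product flip: power2_eq_square)
  then show ?thesis
    using card_Fq_le by simp
qed

lemma two_eq_0_iff: "(2::'k) = 0 \<longleftrightarrow> even q"
proof -
  obtain h where h: "q = CHAR('k) ^ h" "h > 0"
    by (rule q_power_of_CHAR)
  have "(2::'k) = 0 \<longleftrightarrow> CHAR('k) dvd 2"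
    using of_nat_eq_0_iff_char_dvd[of 2, where 'a = 'k] by simp
  also have "\<dots> \<longleftrightarrow> CHAR('k) = 2"
    using prime_CHAR primes_dvd_imp_eq[of "CHAR('k)" 2] by auto
  also have "\<dots> \<longleftrightarrow> even q"
    using h prime_CHAR primes_dvd_imp_eq[of 2 "CHAR('k)"] by auto
  finally show ?thesis .
qed

section \<open>Imaginary chords as sets of traces\<close>

text \<open>On the line over \<open>k\<close> joining \<open>P(t)\<close> and
  \<open>P(conjg t)\<close>, conjugation fixes exactly the vectors
  \<open>m P(t) + conjg m P(conjg t)\<close>. For \<open>t\<close> outside the subfield these are
  the F_q-rational vectors of the line, zero included.\<close>

definition chord :: "'k \<Rightarrow> 'k list set" where
  "chord t = range (\<lambda>m. map (\<lambda>x. tr (m * x)) (Ppt t))"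

text \<open>Since \<open>t^2 = T * t - N\<close>, the traces of \<open>m * t^2\<close> and
  \<open>m * t^3\<close> follow recursively from \<open>x = tr (m * t)\<close> and
  \<open>y = tr m\<close>, and \<open>(x, y)\<close> takes every value. The chord thereby displays
  the trace and norm of \<open>t\<close>.\<close>

lemma chord_eq_image:
  assumes "t \<notin> Fq q"
  defines "T \<equiv> tr t" and "N \<equiv> t * conjg t"
  shows "chord t = (\<lambda>(x, y). [T * (T * x - N * y) - N * x, T * x - N * y, x, y]) ` (Fq q \<times> Fq q)"
    (is "_ = ?f ` _")
proof
  have *: "map (\<lambda>x. tr (m * x)) (Ppt t) = ?f (tr (m * t), tr m)" for m
    by (simp add: Ppt_def tr_def T_def N_def power2_eq_square power3_eq_cube algebra_simps)
  show "chord t \<subseteq> ?f ` (Fq q \<times> Fq q)"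
    unfolding chord_def * by auto
  show "?f ` (Fq q \<times> Fq q) \<subseteq> chord t"
  proof clarify
    fix x y :: 'k
    assume xy: "x \<in> Fq q" "y \<in> Fq q"
    \<comment> \<open>Cramer's rule for the system \<open>m + m' = y\<close>,
      \<open>m * t + m' * conjg t = x\<close>; the solution satisfies
      \<open>m' = conjg m\<close>.\<close>
    define m where "m = (x - conjg t * y) / (t - conjg t)"
    have ne: "t - conjg t \<noteq> 0"
      using assms(1) by (auto simp: mem_Fq)
    have cm: "conjg m = (t * y - x) / (t - conjg t)"
      using xy minus_divide_divide[of "t * y - x" "t - conjg t"]
      by (simp add: m_def mem_Fq)
    have "tr m = (y * (t - conjg t)) / (t - conjg t)"
      unfolding tr_def cm unfolding m_def add_divide_distrib[symmetric] by (simp add: algebra_simps)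
    moreover have "tr (m * t) = (x * (t - conjg t)) / (t - conjg t)"
      unfolding tr_def conjg_mult cm unfolding m_def times_divide_eq_left add_divide_distrib[symmetric]
      by (simp add: algebra_simps)
    ultimately have "tr m = y" "tr (m * t) = x"
      using ne by auto
    then have "?f (x, y) = map (\<lambda>x. tr (m * x)) (Ppt t)"
      using * by simp
    then show "[T * (T * x - N * y) - N * x, T * x - N * y, x, y] \<in> chord t"
      by (auto simp: chord_def)
  qed
qed

lemma root_of_trace_norm_iff:
  "s\<^sup>2 = tr t * s - t * conjg t \<longleftrightarrow> s = t \<or> s = conjg t"
proof -
  have "s\<^sup>2 = tr t * s - t * conjg t \<longleftrightarrow> (s - t) * (s - conjg t) = 0"
    by (simp add: tr_def power2_eq_square algebra_simps)
  then show ?thesis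
    by simp
qed

lemma chord_eq_iff:
  assumes "s \<notin> Fq q" "t \<notin> Fq q"
  shows "chord s = chord t \<longleftrightarrow> s = t \<or> s = conjg t"
proof
  assume "s = t \<or> s = conjg t"
  moreover have "chord (conjg t) = chord t"
    using assms(2) by (simp add: chord_eq_image tr_def add.commute mult.commute)
  ultimately show "chord s = chord t"
    by auto
next
  assume eq: "chord s = chord t"
  define f where "f u = (\<lambda>(x, y). [tr u * (tr u * x - u * conjg u * y) - u * conjg u * x,
    tr u * x - u * conjg u * y, x, y])" for u
  have "f s ` (Fq q \<times> Fq q) = f t ` (Fq q \<times> Fq q)"
    using eq assms by (simp add: chord_eq_image f_def)
  then have "f s (1, 0) \<in> f t ` (Fq q \<times> Fq q)" "f s (0, 1) \<in> f t ` (Fq q \<times> Fq q)"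
    by auto
  \<comment> \<open>The last two entries identify the preimages, so the second entries can be
    compared: they are the trace and minus the norm.\<close>
  then have "tr s = tr t" "s * conjg s = t * conjg t"
    by (auto simp: f_def)
  then show "s = t \<or> s = conjg t"
    using root_of_trace_norm_iff[of s s] root_of_trace_norm_iff[of s t] by simp
qed

lemma card_chord:
  assumes "t \<notin> Fq q"
  shows "card (chord t) = q\<^sup>2"
  unfolding chord_eq_image[OF assms]
  by (subst card_image) (auto simp: inj_on_def card_cartesian_product card_Fq power2_eq_square)

text \<open>Conjugating \<open>P(t) = a u + b v\<close> shows that the span contains all \<open>Tr(m P(t))\<close>; equality
  follows by counting.\<close>
lemma fq_span_eq_chord:
  assumes t: "t \<notin> Fq q" and uv: "is_fqvec q u" "is_fqvec q v"
    and P: "Ppt t \<in> k_span u v"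
  shows "fq_span q u v = chord t"
proof -
  obtain a b where ab: "Ppt t = vadd (vsc a u) (vsc b v)"
    using P by (auto simp: k_span_def)
  obtain u0 u1 u2 u3 where u: "u = [u0, u1, u2, u3]"
    using uv(1) by (auto simp: is_fqvec_def numeral_eq_Suc length_Suc_conv)
  obtain v0 v1 v2 v3 where v: "v = [v0, v1, v2, v3]"
    using uv(2) by (auto simp: is_fqvec_def numeral_eq_Suc length_Suc_conv)
  have fix_uv: "conjg u0 = u0" "conjg u1 = u1" "conjg u2 = u2" "conjg u3 = u3"
     "conjg v0 = v0" "conjg v1 = v1" "conjg v2 = v2" "conjg v3 = v3"
    using uv by (auto simp: is_fqvec_def u v mem_Fq)
  have "map (\<lambda>x. tr (m * x)) (Ppt t) = vadd (vsc (tr (m * a)) u) (vsc (tr (m * b)) v)" for m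
    unfolding ab by (simp add: u v vadd_def vsc_def tr_def fix_uv algebra_simps)
  then have "map (\<lambda>x. tr (m * x)) (Ppt t) \<in> fq_span q u v" for m
    unfolding fq_span_def using tr_in_Fq by blast
  then have sub: "chord t \<subseteq> fq_span q u v"
    by (auto simp: chord_def)
  have span: "fq_span q u v = (\<lambda>(a, b). vadd (vsc a u) (vsc b v)) ` (Fq q \<times> Fq q)"
    by (auto simp: fq_span_def)
  have "card (fq_span q u v) \<le> card (Fq q \<times> Fq q :: ('k \<times> 'k) set)"
    unfolding span by (rule card_image_le) simp
  also have "\<dots> = card (chord t)"
    by (simp add: card_chord[OF t] card_cartesian_product card_Fq power2_eq_square)
  finally have "card (fq_span q u v) \<le> card (chord t)" .
  moreover have "finite (fq_span q u v)"
    unfolding span by simp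
  ultimately show ?thesis
    using sub card_seteq by metis
qed

lemma imag_chord_chord:
  assumes t: "t \<notin> Fq q"
  shows "imag_chord q (chord t)"
proof -
  define T N where "T = tr t" and "N = t * conjg t"
  \<comment> \<open>The vectors of the chord with last entries \<open>(1, 0)\<close> and
    \<open>(0, 1)\<close>, read off from \<open>chord_eq_image\<close>.\<close>
  define u v where "u = [T\<^sup>2 - N, T, 1, 0]" and "v = [- T * N, - N, 0, 1]"
  have TN: "T \<in> Fq q" "N \<in> Fq q"
    by (simp_all add: T_def N_def mem_Fq tr_def ac_simps)
  then have uv: "is_fqvec q u" "is_fqvec q v"
    by (simp_all add: is_fqvec_def u_def v_def)
  \<comment> \<open>Both \<open>t\<close> and \<open>conjg t\<close> satisfy
    \<open>s^2 = T * s - N\<close>, which gives the first two coordinates.\<close>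
  have P: "Ppt s = vadd (vsc s u) (vsc 1 v)" if "s = t \<or> s = conjg t" for s
    using that by (auto simp: u_def v_def T_def N_def tr_def Ppt_def vadd_def vsc_def
        power2_eq_square power3_eq_cube algebra_simps)
  then have Pt: "Ppt t \<in> k_span u v" "Ppt (t ^ q) \<in> k_span u v"
    unfolding k_span_def conjg_def[symmetric] by blast+
  have "fq_indep q u v"
    by (auto simp: fq_indep_def u_def v_def vadd_def vsc_def numeral_eq_Suc)
  then show ?thesis
    unfolding imag_chord_def using uv Pt t fq_span_eq_chord[OF t uv Pt(1)] by metis
qed

lemma imag_chord_iff: "imag_chord q L \<longleftrightarrow> (\<exists>t. t \<notin> Fq q \<and> L = chord t)"
  using imag_chord_chord fq_span_eq_chord unfolding imag_chord_def by metis

section \<open>The action of the group on chords\<close>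

definition is_gl :: "'k \<Rightarrow> 'k \<Rightarrow> 'k \<Rightarrow> 'k \<Rightarrow> bool" where
  "is_gl a b c d \<longleftrightarrow>
     a \<in> Fq q \<and> b \<in> Fq q \<and> c \<in> Fq q \<and> d \<in> Fq q \<and> a * d - b * c \<noteq> 0"

lemma affine_eq_0_iff:
  fixes t :: 'k
  assumes "t \<notin> Fq q" "c \<in> Fq q" "d \<in> Fq q"
  shows "c * t + d = 0 \<longleftrightarrow> c = 0 \<and> d = 0"
  using Fq_basis_unique[OF assms, of 0 0] by auto

lemma is_gl_denominator:
  assumes "is_gl a b c d" "t \<notin> Fq q"
  shows "c * t + d \<noteq> 0"
  using assms affine_eq_0_iff[of t c d] by (auto simp: is_gl_def)

text \<open>If the determinant vanished, \<open>(a, b)\<close> would be an F_q-multiple of the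
  nonzero pair \<open>(c, d)\<close>, and as \<open>c * t + d\<close> is nonzero that multiple would
  be \<open>s\<close>, which lies outside F_q.\<close>

lemma is_glI:
  assumes "t \<notin> Fq q" "s \<notin> Fq q" "a \<in> Fq q" "b \<in> Fq q" "c \<in> Fq q" "d \<in> Fq q"
    and "c \<noteq> 0 \<or> d \<noteq> 0" and eq: "a * t + b = s * (c * t + d)"
  shows "is_gl a b c d"
proof -
  have ne: "c * t + d \<noteq> 0"
    using affine_eq_0_iff assms(1,5,6,7) by blast
  have "a * d - b * c \<noteq> 0"
  proof
    assume det: "a * d - b * c = 0"
    show False
    proof (cases "c = 0")
      case True
      then have "s = b / d"
        using det eq assms(7) by (simp add: field_simps)
      then show False
        using assms by simp
    next
      case False
      have "c * s * (c * t + d) = c * (a * t + b)"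
        using eq by simp
      also have "\<dots> = a * (c * t + d)"
        using det by (simp add: algebra_simps)
      finally have "s = a / c"
        using ne False by (simp add: eq_divide_eq mult.commute[of s])
      then show False
        using assms by simp
    qed
  qed
  then show ?thesis
    using assms by (simp add: is_gl_def)
qed

text \<open>\<open>Mq a b c d\<close> is the symmetric cube of a linear substitution. This
  polynomial identity also covers the \<open>t\<close> at which \<open>c * t + d\<close>
  vanishes.\<close>

lemma vecmat_Ppt:
  "vecmat (Ppt t) (Mq a b c d) =
    [(a * t + b) ^ 3, (a * t + b)\<^sup>2 * (c * t + d), (a * t + b) * (c * t + d)\<^sup>2, (c * t + d) ^ 3]"
  by (simp add: vecmat_def Mq_def Ppt_def upt_rec numeral_eq_Suc algebra_simps)

lemma vecmat_Ppt_mobius: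
  fixes t :: 'k
  assumes "c * t + d \<noteq> 0"
  shows "vecmat (Ppt t) (Mq a b c d) = vsc ((c * t + d) ^ 3) (Ppt ((a * t + b) / (c * t + d)))"
proof -
  have "[n ^ 3, n\<^sup>2 * e, n * e\<^sup>2, e ^ 3] = vsc (e ^ 3) (Ppt (n / e))" if "e \<noteq> 0" for n e :: 'k
    using that by (simp add: vsc_def Ppt_def power2_eq_square power3_eq_cube)
  then show ?thesis
    using assms vecmat_Ppt by metis
qed

lemma length_Mq: "length (Mq a b c d) = 4" "i < 4 \<Longrightarrow> length (Mq a b c d ! i) = 4"
proof -
  show len: "length (Mq a b c d) = 4"
    by (simp add: Mq_def)
  have "\<forall>r\<in>set (Mq a b c d). length r = 4"
    by (simp add: Mq_def)
  then show "i < 4 \<Longrightarrow> length (Mq a b c d ! i) = 4"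
    using len nth_mem by metis
qed

lemma Mq_entry_in_Fq:
  assumes "is_gl a b c d" "i < 4" "j < 4"
  shows "Mq a b c d ! i ! j \<in> Fq q"
proof -
  have "\<forall>r\<in>set (Mq a b c d). set r \<subseteq> Fq q"
    using assms(1) by (simp add: is_gl_def Mq_def)
  then show ?thesis
    using assms(2,3) length_Mq nth_mem subsetD by metis
qed

text \<open>The entries of the matrix lie in F_q and the trace is F_q-linear.\<close>

lemma vecmat_tr:
  assumes "is_gl a b c d" "length x = 4"
  shows "vecmat (map (\<lambda>x. tr (m * x)) x) (Mq a b c d)
    = map (\<lambda>x. tr (m * x)) (vecmat x (Mq a b c d))"
proof -
  have "tr (m * x ! i) * Mq a b c d ! i ! j = tr (m * (x ! i * Mq a b c d ! i ! j))"
    if "i < 4" "j < 4" for i j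
    using tr_mult_Fq[OF Mq_entry_in_Fq[OF assms(1) that], of "m * x ! i"]
    by (simp add: ac_simps)
  then show ?thesis
    using assms(2) by (auto simp: vecmat_def sum_distrib_left tr_sum intro!: sum.cong)
qed

text \<open>The factor \<open>(c * t + d) ^ 3\<close> only rescales the parameter \<open>m\<close>,
  which runs through all of \<open>k\<close>.\<close>

lemma line_image_chord:
  assumes gl: "is_gl a b c d" and t: "t \<notin> Fq q"
  shows "line_image (Mq a b c d) (chord t) = chord ((a * t + b) / (c * t + d))"
proof -
  define w where "w = (c * t + d) ^ 3"
  have w: "w \<noteq> 0"
    using is_gl_denominator[OF gl t] by (simp add: w_def)
  have "vecmat (map (\<lambda>x. tr (m * x)) (Ppt t)) (Mq a b c d)
      = map (\<lambda>x. tr (m * w * x)) (Ppt ((a * t + b) / (c * t + d)))" for m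
    using vecmat_tr[OF gl, of "Ppt t"] vecmat_Ppt_mobius[OF is_gl_denominator[OF gl t]]
    by (simp add: w_def vsc_def Ppt_def mult.assoc)
  then have "line_image (Mq a b c d) (chord t)
      = (\<lambda>m. map (\<lambda>x. tr (m * x)) (Ppt ((a * t + b) / (c * t + d)))) ` range (\<lambda>m. m * w)"
    by (simp add: line_image_def chord_def image_image)
  moreover have "range (\<lambda>m. m * w) = UNIV"
    using w by (auto intro!: image_eqI[of _ _ "x / w" for x])
  ultimately show ?thesis
    by (simp add: chord_def)
qed

text \<open>With a value in F_q, uniqueness of coordinates in the basis \<open>(t, 1)\<close> would
  make \<open>(a, b)\<close> a multiple of \<open>(c, d)\<close>, against the determinant.\<close>

lemma mobius_notin_Fq:
  assumes gl: "is_gl a b c d" and t: "t \<notin> Fq q"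
  shows "(a * t + b) / (c * t + d) \<notin> Fq q"
proof
  define s where "s = (a * t + b) / (c * t + d)"
  assume "s \<in> Fq q"
  moreover have "a * t + b = s * (c * t + d)"
    using is_gl_denominator[OF gl t] by (simp add: s_def)
  then have "a * t + b = s * c * t + s * d"
    by (simp add: algebra_simps)
  ultimately have "a = s * c" "b = s * d"
    using Fq_basis_unique[OF t, of a b "s * c" "s * d"] gl by (auto simp: is_gl_def)
  then show False
    using gl by (simp add: is_gl_def)
qed

lemma imag_chords_orbit:
  assumes t: "t \<notin> Fq q"
  shows "{L. imag_chord q L} = {line_image (Mq a b c d) (chord t) | a b c d. is_gl a b c d}"
proof (intro equalityI subsetI; clarify)
  fix L :: "'k list set"
  assume "imag_chord q L"
  then obtain s where s: "s \<notin> Fq q" "L = chord s"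
    by (auto simp: imag_chord_iff)
  \<comment> \<open>The affine map taking \<open>t\<close> to \<open>s\<close> has the coordinates
    of \<open>s\<close> in the basis \<open>(t, 1)\<close> as coefficients.\<close>
  let ?a = "coef t s" and ?b = "s - coef t s * t"
  have "is_gl ?a ?b 0 1"
    by (rule is_glI[OF t s(1)]) (simp_all add: coef_in_Fq coef_rest_in_Fq[OF t])
  moreover from this have "line_image (Mq ?a ?b 0 1) (chord t) = L"
    using s(2) by (simp add: line_image_chord[OF _ t])
  ultimately show "\<exists>a b c d. L = line_image (Mq a b c d) (chord t) \<and> is_gl a b c d"
    by (intro exI conjI) (rule sym)
next
  fix a b c d :: 'k
  assume "is_gl a b c d"
  then show "imag_chord q (line_image (Mq a b c d) (chord t))"
    using line_image_chord mobius_notin_Fq t imag_chord_chord by simp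
qed

section \<open>Projective classes and the stabiliser of a chord\<close>

text \<open>A factor in F_q moves through the trace into \<open>m\<close>. Hence all representatives
  of a projective class act alike on chords, and the condition in \<open>stab\<close> can be tested
  on one of them.\<close>

lemma vsc_image_chord:
  assumes l: "l \<in> Fq q" "l \<noteq> 0"
  shows "vsc l ` chord t = chord t"
proof -
  have "vsc l (map (\<lambda>x. tr (m * x)) (Ppt t)) = map (\<lambda>x. tr (l * m * x)) (Ppt t)" for m
    by (simp add: vsc_def mult.assoc tr_mult_Fq[OF l(1)])
  then have "vsc l ` chord t = (\<lambda>m. map (\<lambda>x. tr (m * x)) (Ppt t)) ` range (\<lambda>m. l * m)"
    by (simp add: chord_def image_image)
  moreover have "range (\<lambda>m. l * m) = UNIV"
    using l(2) by (auto intro!: image_eqI[of _ _ "x / l" for x])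
  ultimately show ?thesis
    by (simp add: chord_def)
qed

lemma vecmat_msc: "vecmat x (msc l (Mq a b c d)) = vsc l (vecmat x (Mq a b c d))"
proof -
  have "msc l (Mq a b c d) ! i ! j = l * Mq a b c d ! i ! j" if "i < 4" "j < 4" for i j
    using that by (simp add: msc_def length_Mq)
  then show ?thesis
    by (auto simp: vecmat_def vsc_def sum_distrib_left mult.left_commute intro!: sum.cong)
qed

lemma proj_class_in_Gq: "is_gl a b c d \<Longrightarrow> proj_class q (Mq a b c d) \<in> Gq q"
  unfolding Gq_def is_gl_def by blast

lemma proj_class_in_stab_iff:
  assumes gl: "is_gl a b c d" and t: "t \<notin> Fq q"
  shows "proj_class q (Mq a b c d) \<in> stab q (chord t)
    \<longleftrightarrow> (\<exists>s\<in>{t, conjg t}. a * t + b = s * (c * t + d))"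
proof -
  let ?s = "(a * t + b) / (c * t + d)"
  have "line_image (msc l (Mq a b c d)) (chord t) = chord ?s" if "l \<in> Fq q" "l \<noteq> 0" for l
  proof -
    have "line_image (msc l (Mq a b c d)) (chord t) = vsc l ` line_image (Mq a b c d) (chord t)"
      by (simp add: line_image_def vecmat_msc image_image)
    then show ?thesis
      using line_image_chord[OF gl t] vsc_image_chord[OF that] by simp
  qed
  then have "proj_class q (Mq a b c d) \<in> stab q (chord t) \<longleftrightarrow> chord ?s = chord t"
    using proj_class_in_Gq[OF gl] by (auto simp: stab_def proj_class_def intro!: exI[of _ 1])
  also have "\<dots> \<longleftrightarrow> ?s = t \<or> ?s = conjg t"
    using chord_eq_iff mobius_notin_Fq[OF gl t] t by simp
  also have "\<dots> \<longleftrightarrow> (\<exists>s\<in>{t, conjg t}. a * t + b = s * (c * t + d))"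
    using is_gl_denominator[OF gl t] by (simp add: divide_eq_eq)
  finally show ?thesis .
qed

text \<open>The entries are cubic forms, so the factor comes out as \<open>l ^ 3\<close>, and
  multiplication by it permutes the nonzero scalars of F_q. This permits normalising
  \<open>(c, d)\<close>.\<close>

lemma proj_class_scale:
  fixes a b c d l :: 'k
  assumes l: "l \<in> Fq q" "l \<noteq> 0"
  shows "proj_class q (Mq (l * a) (l * b) (l * c) (l * d)) = proj_class q (Mq a b c d)"
proof -
  have Mq: "Mq (l * a) (l * b) (l * c) (l * d) = msc (l ^ 3) (Mq a b c d)"
    by (simp add: Mq_def msc_def power2_eq_square power3_eq_cube algebra_simps)
  have "{m * l ^ 3 | m. m \<in> Fq q \<and> m \<noteq> 0} = {m \<in> Fq q. m \<noteq> 0}" (is "?A = ?B")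
  proof
    show "?B \<subseteq> ?A"
    proof
      fix m assume "m \<in> ?B"
      then show "m \<in> ?A"
        using l by (auto intro!: exI[of _ "m / l ^ 3"])
    qed
  qed (use l in auto)
  then have "(\<lambda>m. msc m (Mq a b c d)) ` {m * l ^ 3 | m. m \<in> Fq q \<and> m \<noteq> 0} = proj_class q (Mq a b c d)"
    by (auto simp: proj_class_def)
  moreover have "proj_class q (msc (l ^ 3) (Mq a b c d))
      = (\<lambda>m. msc m (Mq a b c d)) ` {m * l ^ 3 | m. m \<in> Fq q \<and> m \<noteq> 0}"
    by (auto simp: proj_class_def msc_def mult.assoc image_iff)
  ultimately show ?thesis
    by (simp add: Mq)
qed

text \<open>A point of the twisted cubic determines its parameter \<open>(u : v)\<close>: by the
  fourth coordinate \<open>v\<close> and \<open>v'\<close> vanish together, and otherwise the third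
  and fourth coordinates give the ratio.\<close>

lemma proportional_pairs:
  fixes u v :: 'k
  assumes "l \<noteq> 0"
    and "[u ^ 3, u\<^sup>2 * v, u * v\<^sup>2, v ^ 3] = vsc l [u' ^ 3, u'\<^sup>2 * v', u' * v'\<^sup>2, v' ^ 3]"
  shows "u * v' = v * u'"
proof -
  have eqs: "u ^ 3 = l * u' ^ 3" "u * v\<^sup>2 = l * (u' * v'\<^sup>2)" "v ^ 3 = l * v' ^ 3"
    using assms(2) unfolding vsc_def list.map list.inject by blast+
  show ?thesis
  proof (cases "v = 0")
    case True
    then show ?thesis
      using assms(1) eqs by simp
  next
    case False
    have "(u * v') * (l * (v'\<^sup>2 * v\<^sup>2)) = (v * u') * (l * (v'\<^sup>2 * v\<^sup>2))"
    proof -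
      have "(u * v') * (l * (v'\<^sup>2 * v\<^sup>2)) = (u * v\<^sup>2) * (l * v' ^ 3)"
        by (simp add: power2_eq_square power3_eq_cube)
      also have "\<dots> = (l * (u' * v'\<^sup>2)) * v ^ 3"
        using eqs(2,3) by simp
      finally show ?thesis
        by (simp add: power2_eq_square power3_eq_cube ac_simps)
    qed
    moreover have "v' \<noteq> 0"
      using False eqs(3) by auto
    ultimately show ?thesis
      using False assms(1) by simp
  qed
qed

text \<open>Equal classes induce the same map of the projective line; comparing it at
  \<open>\<infinity>\<close>, \<open>0\<close> and \<open>1\<close> gives these equations.\<close>
lemma proj_class_eqD:
  fixes a b c d :: 'k
  assumes "proj_class q (Mq a b c d) = proj_class q (Mq a' b' c' d')"
  shows "a * c' = c * a'" "b * d' = d * b'" "(a + b) * (c' + d') = (c + d) * (a' + b')"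
proof -
  have "msc 1 (Mq a b c d) = Mq a b c d"
    by (simp add: msc_def Mq_def)
  then have "Mq a b c d \<in> proj_class q (Mq a b c d)"
    by (auto simp: proj_class_def intro!: exI[of _ 1])
  then obtain l where l: "l \<noteq> 0" "Mq a b c d = msc l (Mq a' b' c' d')"
    unfolding assms unfolding proj_class_def by blast
  \<comment> \<open>The first row of the matrix is the image of the point at infinity, which is not
    of the form \<open>Ppt x\<close>.\<close>
  have row: "hd (Mq x y z w) = [x ^ 3, x\<^sup>2 * z, x * z\<^sup>2, z ^ 3]"
    "hd (msc l (Mq x y z w)) = vsc l (hd (Mq x y z w))" for x y z w
    by (simp_all add: Mq_def msc_def vsc_def)
  show "a * c' = c * a'"
    using arg_cong[OF l(2), of hd] unfolding row by (rule proportional_pairs[OF l(1)])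
  have *: "(a * x + b) * (c' * x + d') = (c * x + d) * (a' * x + b')" for x
  proof -
    have "vecmat (Ppt x) (Mq a b c d) = vsc l (vecmat (Ppt x) (Mq a' b' c' d'))"
      unfolding l(2) by (rule vecmat_msc)
    then show ?thesis
      unfolding vecmat_Ppt by (rule proportional_pairs[OF l(1)])
  qed
  show "b * d' = d * b'"
    using *[of 0] by simp
  show "(a + b) * (c' + d') = (c + d) * (a' + b')"
    using *[of 1] by simp
qed

text \<open>By \<open>is_glI\<close> the equation with \<open>s\<close> outside F_q turns the
  determinant condition into \<open>(c, d)\<close> being nonzero, so \<open>(c, d)\<close> becomes a
  free parameter.\<close>

lemma stab_chord:
  assumes t: "t \<notin> Fq q"
  shows "stab q (chord t) = {proj_class q (Mq a b c d) | a b c d.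
    a \<in> Fq q \<and> b \<in> Fq q \<and> c \<in> Fq q \<and> d \<in> Fq q \<and> (c \<noteq> 0 \<or> d \<noteq> 0) \<and>
    (\<exists>s\<in>{t, conjg t}. a * t + b = s * (c * t + d))}" (is "_ = ?R")
proof
  show "stab q (chord t) \<subseteq> ?R"
  proof
    fix g assume g: "g \<in> stab q (chord t)"
    then obtain a b c d where gl: "is_gl a b c d" and g_eq: "g = proj_class q (Mq a b c d)"
      by (auto simp: stab_def Gq_def is_gl_def)
    have "\<exists>s\<in>{t, conjg t}. a * t + b = s * (c * t + d)"
      using g proj_class_in_stab_iff[OF gl t] g_eq by simp
    moreover have "c \<noteq> 0 \<or> d \<noteq> 0"
      using gl by (auto simp: is_gl_def)
    ultimately show "g \<in> ?R"
      using gl g_eq unfolding is_gl_def by blast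
  qed
  show "?R \<subseteq> stab q (chord t)"
  proof clarify
    fix a b c d s
    assume *: "a \<in> Fq q" "b \<in> Fq q" "c \<in> Fq q" "d \<in> Fq q" "c \<noteq> 0 \<or> d \<noteq> 0"
      "s \<in> {t, conjg t}" "a * t + b = s * (c * t + d)"
    then have "s \<notin> Fq q"
      using t by auto
    then have "is_gl a b c d"
      using * by (intro is_glI[OF t, of s])
    then show "proj_class q (Mq a b c d) \<in> stab q (chord t)"
      using proj_class_in_stab_iff[OF _ t] *(6,7) by blast
  qed
qed

section \<open>The order of the stabiliser\<close>

text \<open>Two fractional linear maps that agree at infinity, 0 and 1 differ by a scalar, which the
  normalisation of \<open>(c, d)\<close> removes.\<close>

lemma normalized_coords_unique:
  fixes a b c d :: 'k
  assumes det: "a * d - b * c \<noteq> 0" "a' * d' - b' * c' \<noteq> 0"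
    and norm: "c = 1 \<or> c = 0 \<and> d = 1" "c' = 1 \<or> c' = 0 \<and> d' = 1"
    and eqs: "a * c' = c * a'" "b * d' = d * b'" "(a + b) * (c' + d') = (c + d) * (a' + b')"
  shows "a = a' \<and> b = b' \<and> c = c' \<and> d = d'"
proof -
  consider "c = 1" "c' = 1" | "c = 1" "c' = 0" "d' = 1" | "c = 0" "d = 1" "c' = 1"
    | "c = 0" "d = 1" "c' = 0" "d' = 1"
    using norm by blast
  then show ?thesis
  proof cases
    case 1
    then have "a' = a"
      using eqs(1) by simp
    have b': "b' = b + a * (d' - d)"
      using eqs(2,3) 1 \<open>a' = a\<close> by (simp add: algebra_simps)
    have "(a * d - b) * (d' - d) = 0"
      using eqs(2) unfolding b' by (simp add: algebra_simps)
    then have "d' = d"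
      using det(1) 1 by simp
    then show ?thesis
      using b' 1 \<open>a' = a\<close> by simp
  \<comment> \<open>When exactly one of \<open>c\<close>, \<open>c'\<close> is zero, agreement at
    infinity forces \<open>a = 0\<close> or \<open>a' = 0\<close> there, and that determinant
    vanishes.\<close>
  qed (use eqs det in auto)
qed

text \<open>A target \<open>s\<close> among \<open>t\<close>, \<open>conjg t\<close> and a point
  \<open>(c : d)\<close> of the projective line over F_q determine the element, and are determined
  by it: 2 times \<open>q + 1\<close> choices.\<close>

lemma card_stab_chord:
  assumes t: "t \<notin> Fq q"
  shows "card (stab q (chord t)) = 2 * (q + 1)"
proof -
  \<comment> \<open>Normalised representatives of the \<open>q + 1\<close> points
    \<open>(c : d)\<close>.\<close>
  define R where "R = insert (0, 1) (Pair 1 ` Fq q :: ('k \<times> 'k) set)"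
  \<comment> \<open>\<open>A\<close> and \<open>B\<close> are the coordinates of
    \<open>s * (c * t + d)\<close> in the basis \<open>(t, 1)\<close>, hence the only possible
    \<open>a\<close> and \<open>b\<close>.\<close>
  define A where "A s c d = coef t (s * (c * t + d))" for s c d
  define B where "B s c d = s * (c * t + d) - A s c d * t" for s c d
  define F where "F = (\<lambda>(s, c, d). proj_class q (Mq (A s c d) (B s c d) c d))"
  have AB: "A s c d \<in> Fq q" "B s c d \<in> Fq q" "A s c d * t + B s c d = s * (c * t + d)" for s c d
    using coef_in_Fq coef_rest_in_Fq[OF t] by (simp_all add: A_def B_def)
  have s_notin: "s \<notin> Fq q" if "s \<in> {t, conjg t}" for s
    using that t by auto
  have R_D: "c \<in> Fq q" "d \<in> Fq q" "c = 1 \<or> c = 0 \<and> d = 1" if "(c, d) \<in> R" for c d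
    using that by (auto simp: R_def)
  have F_in: "F (s, c, d) \<in> stab q (chord t)" if "s \<in> {t, conjg t}" "(c, d) \<in> R" for s c d
  proof -
    have "c \<noteq> 0 \<or> d \<noteq> 0"
      using R_D(3)[OF that(2)] by auto
    then show ?thesis
      unfolding F_def stab_chord[OF t] case_prod_conv
      using AB[of s c d] R_D(1,2)[OF that(2)] that(1) by blast
  qed
  have "F ` ({t, conjg t} \<times> R) = stab q (chord t)"
  proof
    show "F ` ({t, conjg t} \<times> R) \<subseteq> stab q (chord t)"
      using F_in by auto
    show "stab q (chord t) \<subseteq> F ` ({t, conjg t} \<times> R)"
    proof
      fix g assume "g \<in> stab q (chord t)"
      then obtain a b c d s where g: "g = proj_class q (Mq a b c d)"
        and Fq: "a \<in> Fq q" "b \<in> Fq q" "c \<in> Fq q" "d \<in> Fq q" and cd: "c \<noteq> 0 \<or> d \<noteq> 0"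
        and s: "s \<in> {t, conjg t}" and eq: "a * t + b = s * (c * t + d)"
        unfolding stab_chord[OF t] by blast
      define l where "l = (if c = 0 then 1 / d else 1 / c)"
      have l: "l \<in> Fq q" "l \<noteq> 0"
        using Fq cd by (auto simp: l_def)
      have "(l * c, l * d) \<in> R"
        using Fq cd by (auto simp: R_def l_def)
      moreover have "g = F (s, l * c, l * d)"
      proof -
        have "l * a * t + l * b = s * (l * c * t + l * d)"
          using arg_cong[OF eq, of "\<lambda>x. l * x"] by (simp add: algebra_simps)
        then have "A s (l * c) (l * d) = l * a \<and> B s (l * c) (l * d) = l * b"
          using Fq_basis_unique[OF t AB(1,2)[of s "l * c" "l * d"], of "l * a" "l * b"]
            AB(3)[of s "l * c" "l * d"] Fq l by simp
        then show ?thesis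
          using proj_class_scale[OF l] by (simp add: F_def g)
      qed
      ultimately show "g \<in> F ` ({t, conjg t} \<times> R)"
        using s by blast
    qed
  qed
  moreover have "inj_on F ({t, conjg t} \<times> R)"
  proof (rule inj_onI)
    fix p p'
    assume p: "p \<in> {t, conjg t} \<times> R" "p' \<in> {t, conjg t} \<times> R" and F: "F p = F p'"
    obtain s c d s' c' d' where p_eq: "p = (s, c, d)" "p' = (s', c', d')"
      by (metis prod_cases3)
    then have s: "s \<in> {t, conjg t}" "s' \<in> {t, conjg t}" and R: "(c, d) \<in> R" "(c', d') \<in> R"
      using p by blast+
    define a b a' b' where "a = A s c d" and "b = B s c d" and "a' = A s' c' d'" and "b' = B s' c' d'"
    note ab = a_def b_def a'_def b'_def
    have gl: "is_gl (A s c d) (B s c d) c d" if "s \<in> {t, conjg t}" "(c, d) \<in> R" for s c d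
    proof -
      have "c \<noteq> 0 \<or> d \<noteq> 0"
        using R_D(3)[OF that(2)] by auto
      then show ?thesis
        using is_glI[OF t s_notin[OF that(1)] AB(1,2) R_D(1,2)[OF that(2)] _ AB(3)] by blast
    qed
    have "proj_class q (Mq a b c d) = proj_class q (Mq a' b' c' d')"
      using F by (simp add: F_def ab p_eq)
    note eqs = proj_class_eqD[OF this]
    have det: "a * d - b * c \<noteq> 0" "a' * d' - b' * c' \<noteq> 0"
      using gl[OF s(1) R(1)] gl[OF s(2) R(2)] by (simp_all add: is_gl_def ab)
    have all_eq: "a = a' \<and> b = b' \<and> c = c' \<and> d = d'"
      by (rule normalized_coords_unique[OF det R_D(3)[OF R(1)] R_D(3)[OF R(2)] eqs])
    moreover have "c * t + d \<noteq> 0"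
      using is_gl_denominator[OF gl[OF s(1) R(1)] t] .
    \<comment> \<open>The common fractional linear map takes \<open>t\<close> to both
      \<open>s\<close> and \<open>s'\<close>.\<close>
    ultimately have "s = s'"
      using AB(3)[of s c d] AB(3)[of s' c' d'] unfolding ab by (metis mult_right_cancel)
    then show "p = p'"
      using all_eq p_eq by simp
  qed
  ultimately have "card (stab q (chord t)) = card ({t, conjg t} \<times> R)"
    using card_image by metis
  also have "\<dots> = 2 * (q + 1)"
  proof -
    have "t \<noteq> conjg t"
      using t by (auto simp: mem_Fq)
    moreover have "card R = q + 1"
      unfolding R_def by (subst card_insert_disjoint) (auto simp: card_image inj_on_def card_Fq)
    ultimately show ?thesis
      by (simp add: card_cartesian_product)
  qed
  finally show ?thesis .
qed

section \<open>Square roots and Artin-Schreier roots outside the subfield\<close>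

text \<open>For \<open>conjg e = - e\<close>, squaring maps the \<open>2 * (q - 1)\<close> elements
  of \<open>U\<close> and \<open>e U\<close> into \<open>U\<close>, at most two to one, hence onto.
  A root of a non-square lies in \<open>e U\<close>, where conjugation is negation.\<close>

lemma nonsquare_root:
  assumes "odd q" and r: "r \<in> Fq q" "\<not> (\<exists>x\<in>Fq q. x\<^sup>2 = r)"
  obtains x where "x\<^sup>2 = r" "conjg x = - x"
proof -
  have two: "(2 :: 'k) \<noteq> 0"
    using assms(1) two_eq_0_iff by simp
  have self_neg: "x = 0" if "x = - x" for x :: 'k
  proof -
    have "2 * x = 0"
      using that by (metis mult_2 add.right_inverse)
    then show ?thesis
      using two by simp
  qed
  obtain t :: 'k where t: "t \<notin> Fq q"
    by (rule exists_notin_Fq)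
  define e where "e = t - conjg t"
  have e: "conjg e = - e" "e \<noteq> 0"
    using t by (auto simp: e_def mem_Fq)
  define U where "U = Fq q - {0 :: 'k}"
  have card_U: "card U = q - 1"
    unfolding U_def by (simp add: card_Fq)
  define S where "S = U \<union> (\<lambda>x. e * x) ` U"
  have "U \<inter> (\<lambda>x. e * x) ` U = {}"
  proof -
    have False if "x \<in> U" "y \<in> U" "x = e * y" for x y
    proof -
      have "conjg (e * y) = e * y"
        using that(1) unfolding that(3) by (simp only: U_def mem_Fq Diff_iff)
      moreover have "conjg (e * y) = - (e * y)"
        using that(2) e(1) by (simp add: U_def mem_Fq)
      ultimately have "e * y = - (e * y)"
        by (rule trans[OF sym])
      from self_neg[OF this] show False
        using that(2) e(2) by (simp add: U_def)
    qed
    then show ?thesis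
      by blast
  qed
  then have card_S: "card S = 2 * card U"
    unfolding S_def using e(2) by (subst card_Un_disjoint) (auto simp: card_image inj_on_def)
  have "power2 ` S = U"
  proof (rule two_to_one_surj)
    show "power2 ` S \<subseteq> U"
      using e by (auto simp: S_def U_def mem_Fq power_mult_distrib)
    show "y = x \<or> y = - x" if "y\<^sup>2 = x\<^sup>2" for x y :: 'k
      using that by (simp add: power2_eq_iff)
  qed (simp_all add: card_S)
  moreover have "r \<in> U"
    using r by (auto simp: U_def)
  ultimately obtain x where x: "x \<in> S" "x\<^sup>2 = r"
    by blast
  then have "x \<notin> U"
    using r(2) by (auto simp: U_def)
  then have "conjg x = - x"
    using x(1) e(1) by (auto simp: S_def U_def mem_Fq)
  then show ?thesis
    using that x(2) by blast
qed

lemma char_2: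
  assumes "even q"
  shows "x + x = (0 :: 'k)" "- x = (x :: 'k)"
proof -
  show "x + x = 0"
    using assms two_eq_0_iff by (simp flip: mult_2)
  then show "- x = x"
    by (simp add: minus_unique)
qed

lemma conjg_eq_add_1:
  assumes "even q" "tr x = 1"
  shows "conjg x = x + 1"
proof -
  have "conjg x = x + x + conjg x"
    by (simp only: char_2(1)[OF assms(1)] add_0_left)
  also have "\<dots> = x + tr x"
    by (simp only: tr_def add.assoc)
  finally show ?thesis
    by (simp only: assms(2))
qed

text \<open>In characteristic 2 the sum telescopes: its first \<open>n\<close> terms add up to
  \<open>x ^ 2 ^ n + x\<close>, which is \<open>conjg x + x\<close> once
  \<open>2 ^ n = q\<close>.\<close>

lemma abs_trace_artin_schreier:
  fixes x :: 'k
  assumes "even q"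
  shows "abs_trace q (x\<^sup>2 + x) = tr x"
proof -
  obtain h where h: "q = CHAR('k) ^ h" "h > 0"
    by (rule q_power_of_CHAR)
  have "CHAR('k) = 2"
    using h assms prime_CHAR primes_dvd_imp_eq[of 2 "CHAR('k)"] by auto
  then have q: "q = 2 ^ h"
    using h by simp
  then have least: "(LEAST h. 2 ^ h = q) = h"
    by (intro Least_equality) auto
  have "(\<Sum>i<n. (x\<^sup>2 + x) ^ 2 ^ i) = x ^ 2 ^ n + x" for n
  proof (induction n)
    case 0
    then show ?case
      using char_2[OF assms] by simp
  next
    case (Suc n)
    have "(x\<^sup>2 + x) ^ 2 ^ n = x ^ 2 ^ Suc n + x ^ 2 ^ n"
      using freshmans_dream'[OF prime_CHAR, of "2 ^ n" n "x\<^sup>2" x] \<open>CHAR('k) = 2\<close>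
      by (simp flip: power_mult)
    then have "(\<Sum>i<Suc n. (x\<^sup>2 + x) ^ 2 ^ i)
        = x ^ 2 ^ Suc n + x + (x ^ 2 ^ n + x ^ 2 ^ n)"
      using Suc by simp
    then show ?case
      using char_2(1)[OF assms] by simp
  qed
  then show ?thesis
    unfolding abs_trace_def least by (simp add: tr_def conjg_def q[symmetric] add.commute)
qed

lemma artin_schreier_fibre:
  fixes x y :: 'k
  assumes "y\<^sup>2 + y = x\<^sup>2 + x"
  shows "y = x \<or> y = - (x + 1)"
proof -
  have "(y - x) * (y + (x + 1)) = (y\<^sup>2 + y) - (x\<^sup>2 + x)"
    by (simp add: power2_eq_square algebra_simps)
  then have "(y - x) * (y + (x + 1)) = 0"
    unfolding assms by simp
  then show ?thesis
    unfolding mult_eq_0_iff right_minus_eq eq_neg_iff_add_eq_0 .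
qed

text \<open>Additive analogue of \<open>nonsquare_root\<close>: for \<open>conjg e = e + 1\<close>,
  the map \<open>x^2 + x\<close> sends the \<open>2 * q\<close> elements of F_q and
  \<open>e + F_q\<close> into F_q, at most two to one, hence onto.\<close>

lemma artin_schreier_root:
  assumes "even q" and r: "r \<in> Fq q" "abs_trace q r = 1"
  obtains x where "x\<^sup>2 + x = r" "conjg x = x + 1"
proof -
  note char_2 = char_2[OF assms(1)]
  obtain t :: 'k where t: "t \<notin> Fq q"
    by (rule exists_notin_Fq)
  have "tr t \<noteq> 0"
    using t char_2(2)[of t] by (auto simp: tr_def mem_Fq add_eq_0_iff)
  \<comment> \<open>Dividing by the trace, an element of F_q, normalises the trace to 1.\<close>
  define e where "e = t / tr t"
  have "conjg (tr t) = tr t"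
    using tr_in_Fq mem_Fq by blast
  then have "tr e = 1"
    using \<open>tr t \<noteq> 0\<close> by (simp add: e_def tr_def add.commute[of "conjg t"] flip: add_divide_distrib)
  then have e: "conjg e = e + 1"
    using conjg_eq_add_1 assms(1) by blast
  define S where "S = Fq q \<union> (\<lambda>x. e + x) ` Fq q"
  have "Fq q \<inter> (\<lambda>x. e + x) ` Fq q = {}"
    using e by (auto simp: mem_Fq)
  then have card_S: "card S = 2 * card (Fq q :: 'k set)"
    unfolding S_def by (subst card_Un_disjoint) (auto simp: card_image)
  have "(\<lambda>x. x\<^sup>2 + x) ` S = Fq q"
  proof (rule two_to_one_surj[where g = "\<lambda>x. - (x + 1)"])
    have "(e + x)\<^sup>2 + (e + x) \<in> Fq q" if "x \<in> Fq q" for x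
    proof -
      have "conjg (e + x) = e + x + 1"
        using that by (simp add: mem_Fq e add_ac)
      then have "conjg ((e + x)\<^sup>2 + (e + x)) = (e + x + 1)\<^sup>2 + (e + x + 1)"
        by (simp only: conjg_add conjg_power)
      also have "\<dots> = (e + x)\<^sup>2 + (e + x) + ((e + x + 1) + (e + x + 1))"
        by (simp add: power2_eq_square algebra_simps)
      finally have "conjg ((e + x)\<^sup>2 + (e + x))
          = (e + x)\<^sup>2 + (e + x) + ((e + x + 1) + (e + x + 1))" .
      then show ?thesis
        by (simp only: mem_Fq char_2(1) add_0_right)
    qed
    moreover have "x\<^sup>2 + x \<in> Fq q" if "x \<in> Fq q" for x :: 'k
      using that by simp
    ultimately show "(\<lambda>x. x\<^sup>2 + x) ` S \<subseteq> Fq q"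
      unfolding S_def by blast
    show "y = x \<or> y = - (x + 1)" if "y\<^sup>2 + y = x\<^sup>2 + x" for x y :: 'k
      using that by (rule artin_schreier_fibre)
    show "finite S" "finite (Fq q :: 'k set)"
      by simp_all
    show "2 * card (Fq q :: 'k set) \<le> card S"
      by (rule eq_refl[OF sym[OF card_S]])
  qed
  then have "r \<in> (\<lambda>x. x\<^sup>2 + x) ` S"
    by (rule ssubst) (rule r(1))
  then obtain x where x: "x \<in> S" "x\<^sup>2 + x = r"
    by (auto simp only: image_iff)
  \<comment> \<open>The absolute trace of \<open>r\<close> is the relative trace of
    \<open>x\<close>, which would be 0 for \<open>x\<close> in F_q.\<close>
  have "tr x = 1"
    using r(2) abs_trace_artin_schreier[OF assms(1), of x] unfolding x(2) by (rule trans[OF sym, rotated])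
  then have "conjg x = x + 1"
    using conjg_eq_add_1 assms(1) by blast
  then show ?thesis
    using that x(2) by blast
qed

section \<open>The explicit lines for odd and even q\<close>

lemma odd_line_stab:
  fixes r :: 'k
  assumes "odd q" and r: "r \<in> Fq q" "\<not> (\<exists>x\<in>Fq q. x\<^sup>2 = r)"
  defines "L \<equiv> fq_span q [1, 0, r, 0] [0, 1, 0, r]"
  shows "imag_chord q L"
    and "stab q L = {proj_class q (Mq (\<alpha> * d) b (\<alpha> * r * b) d) | \<alpha> b d.
      \<alpha> \<in> {-1, 1} \<and> b \<in> Fq q \<and> d \<in> Fq q \<and> (b \<noteq> 0 \<or> d \<noteq> 0)}" (is "_ = ?R")
proof -
  obtain x where x: "x\<^sup>2 = r" "conjg x = - x"
    using nonsquare_root assms by blast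
  have r0: "r \<noteq> 0"
    using r(2) by force
  \<comment> \<open>On this line the last two coordinates are \<open>r\<close> times the first two,
    so \<open>P(t)\<close> lies on it when \<open>r * t^2 = 1\<close>.\<close>
  define t where "t = x / r"
  have x_notin: "x \<notin> Fq q"
    using x(1) r(2) by blast
  have t: "t \<notin> Fq q"
  proof
    assume "t \<in> Fq q"
    then have "t * r \<in> Fq q"
      using r(1) by simp
    then show False
      using x_notin r0 by (simp add: t_def)
  qed
  have t2: "t\<^sup>2 = 1 / r"
    using r0 x(1) by (simp add: t_def power_divide power2_eq_square[of r])
  have conjg_t: "conjg t = - t"
    using x(2) r(1) by (simp add: t_def mem_Fq)
  have t3: "t ^ 3 = t / r"
    using t2 by (simp add: power3_eq_cube flip: power2_eq_square)
  have L: "L = chord t"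
    unfolding L_def
  proof (rule fq_span_eq_chord[OF t])
    have "Ppt t = vadd (vsc (t / r) [1, 0, r, 0]) (vsc (1 / r) [0, 1, 0, r])"
      using r0 by (simp add: Ppt_def vadd_def vsc_def t2 t3)
    then show "Ppt t \<in> k_span [1, 0, r, 0] [0, 1, 0, r]"
      unfolding k_span_def by blast
  qed (use r in \<open>simp_all add: is_fqvec_def\<close>)
  then show "imag_chord q L"
    using imag_chord_chord t by simp
  \<comment> \<open>Coordinates in the basis \<open>(t, 1)\<close> are compared after inserting
    \<open>t^2 = 1 / r\<close>; \<open>\<alpha>\<close> is its own inverse, so
    \<open>b = \<alpha> * c / r\<close> can be solved for \<open>c\<close>.\<close>
  have key: "a * t + b = \<alpha> * t * (c * t + d) \<longleftrightarrow> a = \<alpha> * d \<and> c = \<alpha> * r * b"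
    if "a \<in> Fq q" "b \<in> Fq q" "c \<in> Fq q" "d \<in> Fq q" "\<alpha> \<in> {-1, 1}" for a b c d \<alpha> :: 'k
  proof -
    have "\<alpha> * t * (c * t + d) = \<alpha> * d * t + \<alpha> * c * t\<^sup>2"
      by (simp add: power2_eq_square algebra_simps)
    then have eq: "\<alpha> * t * (c * t + d) = \<alpha> * d * t + \<alpha> * c / r"
      by (simp add: t2)
    have "a * t + b = \<alpha> * d * t + \<alpha> * c / r \<longleftrightarrow> a = \<alpha> * d \<and> b = \<alpha> * c / r"
      using Fq_basis_unique[OF t, of a b "\<alpha> * d" "\<alpha> * c / r"] that r(1) by auto
    also have "b = \<alpha> * c / r \<longleftrightarrow> c = \<alpha> * r * b"
      using that(5) r0 by (auto simp: eq_divide_eq mult.commute)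
    finally show ?thesis
      by (simp only: eq)
  qed
  \<comment> \<open>The sign \<open>\<alpha>\<close> records whether the target is \<open>t\<close>
    or \<open>conjg t = - t\<close>.\<close>
  have ex: "(\<exists>s\<in>{t, conjg t}. P s) \<longleftrightarrow> (\<exists>\<alpha>\<in>{-1, 1}. P (\<alpha> * t))" for P
    by (auto simp: conjg_t)
  show "stab q L = ?R"
  proof
    show "stab q L \<subseteq> ?R"
      unfolding L stab_chord[OF t] ex
    proof clarify
      fix a b c d \<alpha> :: 'k
      assume *: "a \<in> Fq q" "b \<in> Fq q" "c \<in> Fq q" "d \<in> Fq q" "c \<noteq> 0 \<or> d \<noteq> 0"
        "\<alpha> \<in> {-1, 1}" "a * t + b = \<alpha> * t * (c * t + d)"
      then have "a = \<alpha> * d" "c = \<alpha> * r * b"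
        using key by blast+
      then show "\<exists>\<alpha>' b' d'. proj_class q (Mq a b c d)
          = proj_class q (Mq (\<alpha>' * d') b' (\<alpha>' * r * b') d') \<and>
          \<alpha>' \<in> {-1, 1} \<and> b' \<in> Fq q \<and> d' \<in> Fq q \<and> (b' \<noteq> 0 \<or> d' \<noteq> 0)"
        using * by (intro exI[of _ \<alpha>] exI[of _ b] exI[of _ d]) auto
    qed
    show "?R \<subseteq> stab q L"
      unfolding L stab_chord[OF t] ex
    proof clarify
      fix \<alpha> b d :: 'k
      assume *: "\<alpha> \<in> {-1, 1}" "b \<in> Fq q" "d \<in> Fq q" "b \<noteq> 0 \<or> d \<noteq> 0"
      then have Fq: "\<alpha> * d \<in> Fq q" "\<alpha> * r * b \<in> Fq q"
        using r(1) by auto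
      then have "\<alpha> * d * t + b = \<alpha> * t * (\<alpha> * r * b * t + d)"
        using key[of "\<alpha> * d" b "\<alpha> * r * b" d \<alpha>] * by blast
      moreover have "\<alpha> * r * b \<noteq> 0 \<or> d \<noteq> 0"
        using * r0 by auto
      ultimately show "\<exists>a' b' c' d'. proj_class q (Mq (\<alpha> * d) b (\<alpha> * r * b) d)
          = proj_class q (Mq a' b' c' d') \<and>
          a' \<in> Fq q \<and> b' \<in> Fq q \<and> c' \<in> Fq q \<and> d' \<in> Fq q \<and> (c' \<noteq> 0 \<or> d' \<noteq> 0) \<and>
          (\<exists>\<alpha>\<in>{-1, 1}. a' * t + b' = \<alpha> * t * (c' * t + d'))"
        using * Fq by blast
    qed
  qed
qed

lemma even_line_stab:
  fixes r :: 'k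
  assumes "even q" and r: "r \<in> Fq q" "abs_trace q r = 1"
  defines "L \<equiv> fq_span q [r + 1, 1, 1, 0] [r, r, 0, 1]"
  shows "imag_chord q L"
    and "stab q L = {proj_class q (Mq (\<alpha> * c + d) (r * c + (\<alpha> + 1) * d) c d) | \<alpha> c d.
      \<alpha> \<in> {0, 1} \<and> c \<in> Fq q \<and> d \<in> Fq q \<and> (c \<noteq> 0 \<or> d \<noteq> 0)}" (is "_ = ?R")
proof -
  note char_2 = char_2[OF assms(1)]
  obtain t where root: "t\<^sup>2 + t = r" and conjg_t: "conjg t = t + 1"
    using artin_schreier_root assms by blast
  have t: "t \<notin> Fq q"
    using conjg_t by (simp add: mem_Fq)
  have t2: "t\<^sup>2 = t + r"
  proof -
    have "t + r = t\<^sup>2 + (t + t)"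
      unfolding root[symmetric] by (simp only: ac_simps)
    then show ?thesis
      by (simp only: char_2(1) add_0_right)
  qed
  have t3: "t ^ 3 = t * (r + 1) + r"
  proof -
    have "t ^ 3 = t * t\<^sup>2"
      by (simp add: power2_eq_square power3_eq_cube)
    also have "\<dots> = t * (t + r)"
      by (rule arg_cong[OF t2])
    also have "\<dots> = t\<^sup>2 + t * r"
      by (simp only: distrib_left power2_eq_square)
    also have "\<dots> = t * (r + 1) + r"
      unfolding t2 by (simp add: distrib_left)
    finally show ?thesis .
  qed
  have L: "L = chord t"
    unfolding L_def
  proof (rule fq_span_eq_chord[OF t])
    \<comment> \<open>Here \<open>t\<close> has trace 1 and norm \<open>r\<close>, and the spanning
      vectors are those of \<open>imag_chord_chord\<close> with \<open>T = 1\<close>,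
      \<open>N = r\<close>, up to signs that disappear in characteristic 2.\<close>
    have "Ppt t = vadd (vsc t [r + 1, 1, 1, 0]) (vsc 1 [r, r, 0, 1])"
      by (simp add: Ppt_def vadd_def vsc_def t2 t3)
    then show "Ppt t \<in> k_span [r + 1, 1, 1, 0] [r, r, 0, 1]"
      unfolding k_span_def by blast
  qed (use r in \<open>simp_all add: is_fqvec_def\<close>)
  then show "imag_chord q L"
    using imag_chord_chord t by simp
  have key: "a * t + b = (t + (\<alpha> + 1)) * (c * t + d)
      \<longleftrightarrow> a = \<alpha> * c + d \<and> b = r * c + (\<alpha> + 1) * d"
    if "a \<in> Fq q" "b \<in> Fq q" "c \<in> Fq q" "d \<in> Fq q" "\<alpha> \<in> {0, 1}" for a b c d \<alpha> :: 'k
  proof -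
    have "(t + (\<alpha> + 1)) * (c * t + d) = c * t\<^sup>2 + (d + \<alpha> * c + c) * t + (\<alpha> + 1) * d"
      by (simp add: power2_eq_square algebra_simps)
    also have "\<dots> = (\<alpha> * c + d) * t + (r * c + (\<alpha> + 1) * d) + (c * t + c * t)"
      unfolding t2 by (simp only: distrib_left distrib_right ac_simps)
    finally have eq: "(t + (\<alpha> + 1)) * (c * t + d) = (\<alpha> * c + d) * t + (r * c + (\<alpha> + 1) * d)"
      by (simp only: char_2(1) add_0_right)
    show ?thesis
      unfolding eq
      using Fq_basis_unique[OF t, of a b "\<alpha> * c + d" "r * c + (\<alpha> + 1) * d"] that r(1) by auto
  qed
  \<comment> \<open>As \<open>1 + 1 = 0\<close>, the value \<open>\<alpha> = 1\<close> stands for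
    the target \<open>t\<close> and \<open>\<alpha> = 0\<close> for
    \<open>conjg t = t + 1\<close>.\<close>
  have ex: "(\<exists>s\<in>{t, conjg t}. P s) \<longleftrightarrow> (\<exists>\<alpha>\<in>{0, 1}. P (t + (\<alpha> + 1)))" for P
    using char_2(1)[of 1] by (auto simp: conjg_t)
  show "stab q L = ?R"
  proof
    show "stab q L \<subseteq> ?R"
      unfolding L stab_chord[OF t] ex
    proof clarify
      fix a b c d \<alpha> :: 'k
      assume *: "a \<in> Fq q" "b \<in> Fq q" "c \<in> Fq q" "d \<in> Fq q" "c \<noteq> 0 \<or> d \<noteq> 0"
        "\<alpha> \<in> {0, 1}" "a * t + b = (t + (\<alpha> + 1)) * (c * t + d)"
      then have "a = \<alpha> * c + d" "b = r * c + (\<alpha> + 1) * d"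
        using key by blast+
      then show "\<exists>\<alpha>' c' d'. proj_class q (Mq a b c d)
          = proj_class q (Mq (\<alpha>' * c' + d') (r * c' + (\<alpha>' + 1) * d') c' d') \<and>
          \<alpha>' \<in> {0, 1} \<and> c' \<in> Fq q \<and> d' \<in> Fq q \<and> (c' \<noteq> 0 \<or> d' \<noteq> 0)"
        using * by blast
    qed
    show "?R \<subseteq> stab q L"
      unfolding L stab_chord[OF t] ex
    proof clarify
      fix \<alpha> c d :: 'k
      assume *: "\<alpha> \<in> {0, 1}" "c \<in> Fq q" "d \<in> Fq q" "c \<noteq> 0 \<or> d \<noteq> 0"
      then have Fq: "\<alpha> * c + d \<in> Fq q" "r * c + (\<alpha> + 1) * d \<in> Fq q"
        using r(1) by auto
      then have "(\<alpha> * c + d) * t + (r * c + (\<alpha> + 1) * d) = (t + (\<alpha> + 1)) * (c * t + d)"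
        using key * by blast
      then show "\<exists>a' b' c' d'. proj_class q (Mq (\<alpha> * c + d) (r * c + (\<alpha> + 1) * d) c d)
          = proj_class q (Mq a' b' c' d') \<and>
          a' \<in> Fq q \<and> b' \<in> Fq q \<and> c' \<in> Fq q \<and> d' \<in> Fq q \<and> (c' \<noteq> 0 \<or> d' \<noteq> 0) \<and>
          (\<exists>\<alpha>\<in>{0, 1}. a' * t + b' = (t + (\<alpha> + 1)) * (c' * t + d'))"
        using * Fq by blast
    qed
  qed
qed

end

theorem theorem5p4:
  fixes q :: nat
  assumes "card (UNIV :: ('k::{finite,field}) set) = q ^ 2" and "q \<ge> 5"
  shows
   "(\<exists>L0. {L :: 'k list set. imag_chord q L} =
          {line_image (Mq a b c d) L0 | a b c d.
             a \<in> Fq q \<and> b \<in> Fq q \<and> c \<in> Fq q \<and> d \<in> Fq q \<and> a * d - b * c \<noteq> 0})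
    \<and> (\<forall>L :: 'k list set. imag_chord q L \<longrightarrow> card (stab q L) = 2 * (q + 1))
    \<and> (odd q \<longrightarrow>
        (\<forall>\<rho> :: 'k. \<rho> \<in> Fq q \<and> \<not> (\<exists>x\<in>Fq q. x ^ 2 = \<rho>) \<longrightarrow>
           imag_chord q (fq_span q [1, 0, \<rho>, 0] [0, 1, 0, \<rho>]) \<and>
           (\<forall>g\<in>Gq q. g \<in> stab q (fq_span q [1, 0, \<rho>, 0] [0, 1, 0, \<rho>]) \<longleftrightarrow>
              (\<exists>\<alpha> b d. \<alpha> \<in> {-1, 1} \<and> b \<in> Fq q \<and> d \<in> Fq q \<and> (b \<noteq> 0 \<or> d \<noteq> 0) \<and>
                 g = proj_class q
                   [[\<alpha>*d^3, \<alpha>*\<rho>*b*d^2, \<alpha>*\<rho>^2*b^2*d, \<alpha>*\<rho>^3*b^3],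
                    [3*b*d^2, d^3 + 2*\<rho>*b^2*d, \<rho>^2*b^3 + 2*\<rho>*b*d^2, 3*\<rho>^2*b^2*d],
                    [3*\<alpha>*b^2*d, \<alpha>*\<rho>*b^3 + 2*\<alpha>*b*d^2, \<alpha>*d^3 + 2*\<alpha>*\<rho>*b^2*d, 3*\<alpha>*\<rho>*b*d^2],
                    [b^3, b^2*d, b*d^2, d^3]]))))
    \<and> (even q \<longrightarrow>
        (\<forall>\<eta> :: 'k. \<eta> \<in> Fq q \<and> abs_trace q \<eta> = 1 \<longrightarrow>
           imag_chord q (fq_span q [\<eta> + 1, 1, 1, 0] [\<eta>, \<eta>, 0, 1]) \<and>
           (\<forall>g\<in>Gq q. g \<in> stab q (fq_span q [\<eta> + 1, 1, 1, 0] [\<eta>, \<eta>, 0, 1]) \<longleftrightarrow>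
              (\<exists>\<alpha> c d. \<alpha> \<in> {0, 1} \<and> c \<in> Fq q \<and> d \<in> Fq q \<and> (c \<noteq> 0 \<or> d \<noteq> 0) \<and>
                 (let A = \<alpha>*c + d; B = \<eta>*c + (\<alpha> + 1)*d in
                  g = proj_class q
                   [[A^3, c*A^2, c^2*A, c^3],
                    [A^2*B, d*A^2, c^2*B, c^2*d],
                    [A*B^2, c*B^2, A*d^2, c*d^2],
                    [B^3, d*B^2, d^2*B, d^3]])))))"
proof (intro conjI allI impI)
  interpret quadratic_extension q "TYPE('k)"
    using assms(1) by unfold_locales
  obtain t :: 'k where t: "t \<notin> Fq q"
    by (rule exists_notin_Fq)
  show "\<exists>L0. {L :: 'k list set. imag_chord q L} =
      {line_image (Mq a b c d) L0 | a b c d.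
        a \<in> Fq q \<and> b \<in> Fq q \<and> c \<in> Fq q \<and> d \<in> Fq q \<and> a * d - b * c \<noteq> 0}"
    using imag_chords_orbit[OF t] unfolding is_gl_def by (rule exI)
  show "card (stab q L) = 2 * (q + 1)" if "imag_chord q L" for L :: "'k list set"
    using that card_stab_chord by (auto simp: imag_chord_iff)
  show "imag_chord q (fq_span q [1, 0, \<rho>, 0] [0, 1, 0, \<rho>])"
    if "odd q" "\<rho> \<in> Fq q \<and> \<not> (\<exists>x\<in>Fq q. x ^ 2 = \<rho>)" for \<rho> :: 'k
    using odd_line_stab(1) that by blast
  show "\<forall>g\<in>Gq q. g \<in> stab q (fq_span q [1, 0, \<rho>, 0] [0, 1, 0, \<rho>]) \<longleftrightarrow>
      (\<exists>\<alpha> b d. \<alpha> \<in> {-1, 1} \<and> b \<in> Fq q \<and> d \<in> Fq q \<and> (b \<noteq> 0 \<or> d \<noteq> 0) \<and>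
         g = proj_class q
           [[\<alpha>*d^3, \<alpha>*\<rho>*b*d^2, \<alpha>*\<rho>^2*b^2*d, \<alpha>*\<rho>^3*b^3],
            [3*b*d^2, d^3 + 2*\<rho>*b^2*d, \<rho>^2*b^3 + 2*\<rho>*b*d^2, 3*\<rho>^2*b^2*d],
            [3*\<alpha>*b^2*d, \<alpha>*\<rho>*b^3 + 2*\<alpha>*b*d^2, \<alpha>*d^3 + 2*\<alpha>*\<rho>*b^2*d, 3*\<alpha>*\<rho>*b*d^2],
            [b^3, b^2*d, b*d^2, d^3]])"
    if "odd q" "\<rho> \<in> Fq q \<and> \<not> (\<exists>x\<in>Fq q. x ^ 2 = \<rho>)" for \<rho> :: 'k
  proof -
    \<comment> \<open>The stated form arises from \<open>\<alpha>^2 = 1\<close>, which reduces every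
      power of \<open>\<alpha>\<close>.\<close>
    have M: "Mq (\<alpha> * d) b (\<alpha> * \<rho> * b) d =
       [[\<alpha>*d^3, \<alpha>*\<rho>*b*d^2, \<alpha>*\<rho>^2*b^2*d, \<alpha>*\<rho>^3*b^3],
        [3*b*d^2, d^3 + 2*\<rho>*b^2*d, \<rho>^2*b^3 + 2*\<rho>*b*d^2, 3*\<rho>^2*b^2*d],
        [3*\<alpha>*b^2*d, \<alpha>*\<rho>*b^3 + 2*\<alpha>*b*d^2, \<alpha>*d^3 + 2*\<alpha>*\<rho>*b^2*d, 3*\<alpha>*\<rho>*b*d^2],
        [b^3, b^2*d, b*d^2, d^3]]" if "\<alpha> \<in> {-1, 1}" for \<alpha> b d
      using that by (auto simp: Mq_def power2_eq_square power3_eq_cube algebra_simps)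
    have \<rho>: "\<rho> \<in> Fq q" "\<not> (\<exists>x\<in>Fq q. x ^ 2 = \<rho>)"
      using that(2) by simp_all
    show ?thesis
      unfolding odd_line_stab(2)[OF that(1) \<rho>] mem_Collect_eq
      by (intro ballI iff_exI) (metis M)
  qed
  show "imag_chord q (fq_span q [\<eta> + 1, 1, 1, 0] [\<eta>, \<eta>, 0, 1])"
    if "even q" "\<eta> \<in> Fq q \<and> abs_trace q \<eta> = 1" for \<eta> :: 'k
    using even_line_stab(1) that by blast
  show "\<forall>g\<in>Gq q. g \<in> stab q (fq_span q [\<eta> + 1, 1, 1, 0] [\<eta>, \<eta>, 0, 1]) \<longleftrightarrow>
      (\<exists>\<alpha> c d. \<alpha> \<in> {0, 1} \<and> c \<in> Fq q \<and> d \<in> Fq q \<and> (c \<noteq> 0 \<or> d \<noteq> 0) \<and>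
         (let A = \<alpha>*c + d; B = \<eta>*c + (\<alpha> + 1)*d in
          g = proj_class q
           [[A^3, c*A^2, c^2*A, c^3],
            [A^2*B, d*A^2, c^2*B, c^2*d],
            [A*B^2, c*B^2, A*d^2, c*d^2],
            [B^3, d*B^2, d^2*B, d^3]]))"
    if "even q" "\<eta> \<in> Fq q \<and> abs_trace q \<eta> = 1" for \<eta> :: 'k
  proof -
    \<comment> \<open>With \<open>2 = 0\<close> and \<open>3 = 1\<close> every entry of
      \<open>Mq\<close> collapses to a single monomial.\<close>
    have two: "(2 :: 'k) = 0"
      using \<open>even q\<close> two_eq_0_iff by simp
    have "(3 :: 'k) = 2 + 1"
      by simp
    then have three: "(3 :: 'k) = 1"
      by (simp only: two add_0_left)
    have M: "Mq A B c d =
       [[A^3, c*A^2, c^2*A, c^3],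
        [A^2*B, d*A^2, c^2*B, c^2*d],
        [A*B^2, c*B^2, A*d^2, c*d^2],
        [B^3, d*B^2, d^2*B, d^3]]" for A B c d :: 'k
      unfolding Mq_def two three by (simp add: ac_simps)
    have \<eta>: "\<eta> \<in> Fq q" "abs_trace q \<eta> = 1"
      using that(2) by simp_all
    show ?thesis
      unfolding even_line_stab(2)[OF that(1) \<eta>] mem_Collect_eq Let_def M
      by (intro ballI iff_exI) blast
  qed
qed

end
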